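(* Let $R$ be a finite commutative ring with identity, of order $n$, and let $k\ge 2$ be an integer. Then $$zp_k(R)\ \le\ \frac{n^k-\{n+(k-1)|Z(R)|-k\}\,(n-|Z(R)|)^{k-1}}{n^k},$$ and equality holds if and only if $Z(R)^2=0$.
   Context: All rings are nonzero finite commutative rings with identity. For an integer $k\ge 2$, $zp_k(R)=|\{(x_1,\dots,x_k)\in R^k : x_1x_2\cdots x_k=0\}|/|R|^k$. $Z(R)$ is the set of all zero divisors of $R$, including $0$. $Z(R)^2=0$ means that $xy=0$ for all $x,y\in Z(R)$. *)

theory Defs
  imports Complex_Main "HOL-Algebra.Ring" "HOL-Algebra.Coset" "HOL-Library.FuncSet"
begin

text \<open>The definition makes zero a zero divisor exactly when the ring is nonzero.\<close>
definition zero_divisors :: "('a, 'b) ring_scheme \<Rightarrow> 'a set" where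
  "zero_divisors R =
     {x \<in> carrier R. \<exists>y \<in> carrier R. y \<noteq> \<zero>\<^bsub>R\<^esub> \<and> x \<otimes>\<^bsub>R\<^esub> y = \<zero>\<^bsub>R\<^esub>}"

text \<open>A \<open>k\<close>-tuple is an extensional function on \<open>{1..k}\<close>; \<open>finprod\<close> is the
  multiplicative product of the ring.\<close>
definition zp :: "nat \<Rightarrow> ('a, 'b) ring_scheme \<Rightarrow> real" where
  "zp k R =
     real (card {x \<in> {1..k} \<rightarrow>\<^sub>E carrier R. finprod R x {1..k} = \<zero>\<^bsub>R\<^esub>})
       / real (order R) ^ k"

end

theory Submission
  imports Defs
begin

text \<open>
  Call an element of \<open>R\<close> regular if it is not a zero divisor.  Multiplying by a regular element
  never turns a nonzero element into zero, so a tuple has nonzero product as soon as its entries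
  are nonzero and at most one of them is a zero divisor.  These tuples, called sparse
  below, are easy to count.  With \<open>z = |Z(R)|\<close> and \<open>u = n - z\<close> there are \<open>u ^ k\<close> of them without
  any zero divisor and, for each of the \<open>k\<close> positions, \<open>(z - 1) * u ^ (k - 1)\<close> with a zero divisor
  exactly there.  Altogether this is
  \<open>(u + k * (z - 1)) * u ^ (k - 1) = (n + (k - 1) * z - k) * u ^ (k - 1)\<close>,
  so the asserted bound is the proportion of tuples that are not sparse
  (\<open>card_sparse_tuples\<close>, \<open>sparse_tuple_finprod_nonzero\<close>).

  Equality therefore means that every tuple with nonzero product is sparse.
  If \<open>Z(R)\<^sup>2 = 0\<close>, then two entries in \<open>Z(R)\<close> force the product to vanish, so this holds.
  If \<open>x * y \<noteq> 0\<close> for some \<open>x, y \<in> Z(R)\<close>, then \<open>(x, y, 1, \<dots>, 1)\<close> has nonzero product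
  but is not sparse (\<open>nonzero_tuples_sparse_iff\<close>).
\<close>

section \<open>Regular elements and sparse tuples\<close>

definition regular_elements :: "('a, 'b) ring_scheme \<Rightarrow> 'a set" where
  "regular_elements R = carrier R - zero_divisors R"

definition nonzero_tuples :: "'i set \<Rightarrow> ('a, 'b) ring_scheme \<Rightarrow> ('i \<Rightarrow> 'a) set" where
  "nonzero_tuples I R = {x \<in> I \<rightarrow>\<^sub>E carrier R. finprod R x I \<noteq> \<zero>\<^bsub>R\<^esub>}"

definition sparse_tuples :: "'i set \<Rightarrow> ('a, 'b) ring_scheme \<Rightarrow> ('i \<Rightarrow> 'a) set" where
  "sparse_tuples I R =
     {x \<in> I \<rightarrow>\<^sub>E carrier R. (\<forall>i\<in>I. x i \<noteq> \<zero>\<^bsub>R\<^esub>) \<and>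
        (\<forall>i\<in>I. \<forall>j\<in>I. x i \<in> zero_divisors R \<longrightarrow> x j \<in> zero_divisors R \<longrightarrow> i = j)}"

lemma zero_divisors_subset: "zero_divisors R \<subseteq> carrier R"
  by (auto simp: zero_divisors_def)

lemma regular_elements_subset: "regular_elements R \<subseteq> carrier R"
  by (auto simp: regular_elements_def)

context cring
begin

lemma zero_mem_zero_divisors:
  assumes "\<one> \<noteq> \<zero>"
  shows "\<zero> \<in> zero_divisors R"
  using assms by (auto simp: zero_divisors_def intro!: bexI[of _ \<one>])

lemma one_regular: "\<one> \<in> regular_elements R"
  by (auto simp: regular_elements_def zero_divisors_def)

lemma regular_mult_nonzero:
  assumes "x \<in> regular_elements R" "y \<in> carrier R" "y \<noteq> \<zero>"
  shows "x \<otimes> y \<noteq> \<zero>"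
  using assms by (auto simp: regular_elements_def zero_divisors_def)

lemma regular_mult_closed:
  assumes "x \<in> regular_elements R" "y \<in> regular_elements R"
  shows "x \<otimes> y \<in> regular_elements R"
proof -
  have xy: "x \<in> carrier R" "y \<in> carrier R"
    using assms by (auto simp: regular_elements_def)
  have "w = \<zero>" if "w \<in> carrier R" "(x \<otimes> y) \<otimes> w = \<zero>" for w
  proof (rule ccontr)
    assume "w \<noteq> \<zero>"
    then have "x \<otimes> (y \<otimes> w) \<noteq> \<zero>"
      using assms that(1) xy by (intro regular_mult_nonzero m_closed) auto
    then show False
      using that xy by (simp add: m_assoc)
  qed
  then show ?thesis
    using xy by (auto simp: regular_elements_def zero_divisors_def)
qed

lemma finprod_regular:
  assumes "finite I" "\<And>i. i \<in> I \<Longrightarrow> x i \<in> regular_elements R"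
  shows "finprod R x I \<in> regular_elements R"
  using assms
proof (induction I)
  case empty
  then show ?case by (simp add: one_regular)
next
  case (insert i I)
  have "x \<in> I \<rightarrow> carrier R" "x i \<in> carrier R"
    using insert.prems regular_elements_subset[of R] by blast+
  then show ?case
    using insert by (simp add: regular_mult_closed)
qed

lemma finprod_remove:
  assumes "finite I" "i \<in> I" "x \<in> I \<rightarrow> carrier R"
  shows "finprod R x I = x i \<otimes> finprod R x (I - {i})"
proof -
  have "finprod R x (insert i (I - {i})) = x i \<otimes> finprod R x (I - {i})"
    using assms by (intro finprod_insert) auto
  then show ?thesis
    using assms(2) by (simp add: insert_absorb)
qed

text \<open>The product of all entries other than the zero divisor is regular, because regular
  elements form a submonoid.\<close>
lemma sparse_tuple_finprod_nonzero:
  assumes "\<one> \<noteq> \<zero>" "finite I"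
  shows "sparse_tuples I R \<subseteq> nonzero_tuples I R"
proof
  fix x assume x: "x \<in> sparse_tuples I R"
  then have xc: "x \<in> I \<rightarrow> carrier R"
    by (auto simp: sparse_tuples_def)
  have "finprod R x I \<noteq> \<zero>"
  proof (cases "\<exists>i\<in>I. x i \<in> zero_divisors R")
    case True
    then obtain i where i: "i \<in> I" "x i \<in> zero_divisors R" by blast
    have "finprod R x (I - {i}) \<in> regular_elements R"
      using x i xc assms(2)
      by (intro finprod_regular) (auto simp: sparse_tuples_def regular_elements_def)
    then have "finprod R x (I - {i}) \<otimes> x i \<noteq> \<zero>"
      using x xc i(1) by (intro regular_mult_nonzero) (auto simp: sparse_tuples_def)
    moreover have "finprod R x (I - {i}) \<in> carrier R" "x i \<in> carrier R"
      using xc i(1) by (auto intro!: finprod_closed)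
    ultimately show ?thesis
      using finprod_remove[OF assms(2) i(1) xc] by (simp add: m_comm)
  next
    case False
    then have "finprod R x I \<in> regular_elements R"
      using xc assms(2) by (intro finprod_regular) (auto simp: regular_elements_def)
    then show ?thesis
      using zero_mem_zero_divisors[OF assms(1)] by (auto simp: regular_elements_def)
  qed
  then show "x \<in> nonzero_tuples I R"
    using x by (simp add: sparse_tuples_def nonzero_tuples_def)
qed

section \<open>Counting sparse tuples\<close>

text \<open>Splitting by the position of the zero divisor, if there is one, writes the sparse tuples
  as a disjoint union of boxes.\<close>
lemma sparse_tuples_eq_boxes:
  assumes "\<one> \<noteq> \<zero>"
  shows "sparse_tuples I R = (I \<rightarrow>\<^sub>E regular_elements R) \<union>
    (\<Union>i\<in>I. Pi\<^sub>E I ((\<lambda>_. regular_elements R)(i := zero_divisors R - {\<zero>})))"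
    (is "_ = ?U \<union> (\<Union>i\<in>I. ?A i)")
proof (intro equalityI subsetI)
  fix x assume x: "x \<in> sparse_tuples I R"
  show "x \<in> ?U \<union> (\<Union>i\<in>I. ?A i)"
  proof (cases "\<exists>i\<in>I. x i \<in> zero_divisors R")
    case True
    then obtain i where i: "i \<in> I" "x i \<in> zero_divisors R" by blast
    then have "x \<in> ?A i"
      using x by (auto simp: sparse_tuples_def regular_elements_def PiE_iff)
    then show ?thesis using i by blast
  next
    case False
    then have "x \<in> ?U"
      using x by (auto simp: sparse_tuples_def regular_elements_def PiE_iff)
    then show ?thesis by blast
  qed
next
  fix x assume "x \<in> ?U \<union> (\<Union>i\<in>I. ?A i)"
  then consider "x \<in> ?U" | i where "i \<in> I" "x \<in> ?A i" by blast
  then show "x \<in> sparse_tuples I R"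
  proof cases
    case 1
    then show ?thesis
      using zero_mem_zero_divisors[OF assms]
      by (auto simp: sparse_tuples_def regular_elements_def PiE_iff)
  next
    case 2
    have j: "x j \<in> carrier R \<and> x j \<noteq> \<zero> \<and> (x j \<in> zero_divisors R \<longrightarrow> j = i)" if "j \<in> I" for j
      using PiE_mem[OF 2(2) that] zero_mem_zero_divisors[OF assms] zero_divisors_subset[of R]
      by (auto simp: regular_elements_def split: if_splits)
    have "x \<in> extensional I"
      using 2(2) by (simp add: PiE_iff)
    then show ?thesis
      using j by (auto simp: sparse_tuples_def PiE_iff)
  qed
qed

lemma card_sparse_tuples:
  assumes "\<one> \<noteq> \<zero>" "finite I" "finite (carrier R)"
  shows "card (sparse_tuples I R) = card (regular_elements R) ^ card I +
    card I * ((card (zero_divisors R) - 1) * card (regular_elements R) ^ (card I - 1))"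
proof -
  let ?U = "I \<rightarrow>\<^sub>E regular_elements R"
  let ?B = "\<lambda>i. (\<lambda>_. regular_elements R)(i := zero_divisors R - {\<zero>})"
  let ?A = "\<lambda>i. Pi\<^sub>E I (?B i)"
  have finR: "finite (regular_elements R)" "finite (zero_divisors R)"
    using assms(3) finite_subset[OF regular_elements_subset] finite_subset[OF zero_divisors_subset]
    by auto
  then have finB: "finite (?U)" "\<And>i. finite (?A i)"
    using assms(2) by (auto intro!: finite_PiE)
  have at: "x i \<in> zero_divisors R" if "x \<in> ?A i" "i \<in> I" for x i
    using PiE_mem[OF that] by simp
  have off: "x j \<notin> zero_divisors R" if "x \<in> ?A i" "j \<in> I" "j \<noteq> i" for x i j
    using PiE_mem[OF that(1,2)] that(3) by (simp add: regular_elements_def)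
  have disjU: "?U \<inter> (\<Union>i\<in>I. ?A i) = {}"
    using at by (fastforce simp: regular_elements_def PiE_iff simp del: fun_upd_apply)
  have "?A i \<inter> ?A j = {}" if "i \<in> I" "j \<in> I" "i \<noteq> j" for i j
    using at off that by blast
  then have cardUn: "card (\<Union>i\<in>I. ?A i) = (\<Sum>i\<in>I. card (?A i))"
    using finB assms(2) by (intro card_UN_disjoint) auto
  have cardA: "card (?A i) =
      (card (zero_divisors R) - 1) * card (regular_elements R) ^ (card I - 1)" if "i \<in> I" for i
  proof -
    have "card (?A i) = (\<Prod>j\<in>I. card (?B i j))"
      using assms(2) by (rule card_PiE)
    also have "\<dots> = card (?B i i) * (\<Prod>j\<in>I - {i}. card (?B i j))"
      using assms(2) that by (rule prod.remove)
    also have "(\<Prod>j\<in>I - {i}. card (?B i j)) = (\<Prod>j\<in>I - {i}. card (regular_elements R))"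
      by (intro prod.cong) auto
    also have "?B i i = zero_divisors R - {\<zero>}"
      by simp
    finally show ?thesis
      using that assms(2) zero_mem_zero_divisors[OF assms(1)] finR
      by (simp add: card_Diff_singleton del: fun_upd_apply)
  qed
  have "card (sparse_tuples I R) = card ?U + card (\<Union>i\<in>I. ?A i)"
    unfolding sparse_tuples_eq_boxes[OF assms(1)]
    using finB assms(2) disjU by (intro card_Un_disjoint) auto
  then show ?thesis
    using cardUn cardA assms(2) by (simp add: card_PiE)
qed

section \<open>When every tuple with nonzero product is sparse\<close>

text \<open>A nonzero product of two zero divisors is turned into a tuple by placing its factors at
  \<open>a\<close> and \<open>b\<close> and filling up with ones.  Conversely, two entries with product zero
  can be split off from a tuple containing them, so that the whole product vanishes.\<close>
lemma nonzero_tuples_sparse_iff: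
  assumes "\<one> \<noteq> \<zero>" "finite I" "a \<in> I" "b \<in> I" "a \<noteq> b"
  shows "nonzero_tuples I R \<subseteq> sparse_tuples I R \<longleftrightarrow>
    (\<forall>x\<in>zero_divisors R. \<forall>y\<in>zero_divisors R. x \<otimes> y = \<zero>)"
proof
  assume sub: "nonzero_tuples I R \<subseteq> sparse_tuples I R"
  show "\<forall>x\<in>zero_divisors R. \<forall>y\<in>zero_divisors R. x \<otimes> y = \<zero>"
  proof (intro ballI, rule ccontr)
    fix x y assume xy: "x \<in> zero_divisors R" "y \<in> zero_divisors R" "x \<otimes> y \<noteq> \<zero>"
    have c: "x \<in> carrier R" "y \<in> carrier R"
      using xy zero_divisors_subset[of R] by auto
    define t where "t = (\<lambda>i\<in>I. if i = a then x else if i = b then y else \<one>)"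
    have tc: "t \<in> I \<rightarrow>\<^sub>E carrier R"
      using c by (auto simp: t_def)
    have "finprod R t (I - {a} - {b}) = \<one>"
      by (intro finprod_one_eqI) (auto simp: t_def)
    moreover have "finprod R t I = t a \<otimes> finprod R t (I - {a})"
      using assms tc by (intro finprod_remove) auto
    moreover have "finprod R t (I - {a}) = t b \<otimes> finprod R t (I - {a} - {b})"
      using assms tc by (intro finprod_remove) auto
    ultimately have "finprod R t I = x \<otimes> y"
      using assms c by (simp add: t_def)
    then have "t \<in> sparse_tuples I R"
      using sub tc xy by (auto simp: nonzero_tuples_def)
    then have "t a \<in> zero_divisors R \<longrightarrow> t b \<in> zero_divisors R \<longrightarrow> a = b"
      using assms(3,4) unfolding sparse_tuples_def mem_Collect_eq by metis
    then show False
      using xy assms by (simp add: t_def)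
  qed
next
  assume Z: "\<forall>x\<in>zero_divisors R. \<forall>y\<in>zero_divisors R. x \<otimes> y = \<zero>"
  show "nonzero_tuples I R \<subseteq> sparse_tuples I R"
  proof
    fix x assume x: "x \<in> nonzero_tuples I R"
    then have xc: "x \<in> I \<rightarrow> carrier R" and ne: "finprod R x I \<noteq> \<zero>"
      by (auto simp: nonzero_tuples_def)
    have cl: "finprod R x J \<in> carrier R" if "J \<subseteq> I" for J
      using xc that by (intro finprod_closed) auto
    have "x i \<noteq> \<zero>" if "i \<in> I" for i
      using ne finprod_remove[OF assms(2) that xc] cl[of "I - {i}"] by auto
    moreover have "i = j"
      if ij: "i \<in> I" "j \<in> I" "x i \<in> zero_divisors R" "x j \<in> zero_divisors R" for i j
    proof (rule ccontr)
      assume "i \<noteq> j"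
      then have "finprod R x (I - {i}) = x j \<otimes> finprod R x (I - {i} - {j})"
        using assms(2) ij xc by (intro finprod_remove) auto
      moreover have "x i \<in> carrier R" "x j \<in> carrier R"
        using xc ij by auto
      moreover have rest: "finprod R x (I - {i} - {j}) \<in> carrier R"
        by (rule cl) blast
      ultimately have "finprod R x I = (x i \<otimes> x j) \<otimes> finprod R x (I - {i} - {j})"
        using finprod_remove[OF assms(2) ij(1) xc] by (simp add: m_assoc)
      then show False
        using ne Z ij rest by simp
    qed
    ultimately show "x \<in> sparse_tuples I R"
      using x by (auto simp: sparse_tuples_def nonzero_tuples_def)
  qed
qed

end

section \<open>The bound on the zero product probability\<close>

theorem theorem2p11:
  fixes R :: "('a, 'b) ring_scheme" and n k :: nat
  assumes "cring R"
    and "\<one>\<^bsub>R\<^esub> \<noteq> \<zero>\<^bsub>R\<^esub>"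
    and "finite (carrier R)"
    and "order R = n"
    and "k \<ge> 2"
  defines "z \<equiv> real (card (zero_divisors R))"
  defines "bound \<equiv>
    (real n ^ k - (real n + (real k - 1) * z - real k) * (real n - z) ^ (k - 1)) / real n ^ k"
  shows "zp k R \<le> bound \<and>
    (zp k R = bound \<longleftrightarrow>
      (\<forall>x \<in> zero_divisors R. \<forall>y \<in> zero_divisors R. x \<otimes>\<^bsub>R\<^esub> y = \<zero>\<^bsub>R\<^esub>))"
proof -
  interpret cring R by fact
  let ?I = "{1..k}"
  let ?N = "nonzero_tuples ?I R" and ?S = "sparse_tuples ?I R"
  let ?V = "{x \<in> ?I \<rightarrow>\<^sub>E carrier R. finprod R x ?I = \<zero>\<^bsub>R\<^esub>}"
  have n: "card (carrier R) = n"
    using assms(4) by (simp add: order_def)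
  have "carrier R \<noteq> {}"
    using zero_closed by blast
  then have "n > 0"
    using assms(3) n by (metis card_gt_0_iff)
  then have npos: "real n ^ k > 0"
    by simp
  have finT: "finite (?I \<rightarrow>\<^sub>E carrier R)"
    using assms(3) by (intro finite_PiE) auto
  have finN: "finite ?N"
    by (rule finite_subset[OF _ finT]) (auto simp: nonzero_tuples_def)
  have SN: "?S \<subseteq> ?N"
    using assms(2) by (intro sparse_tuple_finprod_nonzero) auto
  have "card ?V + card ?N = card (?V \<union> ?N)"
    using finN finT by (intro card_Un_disjoint[symmetric]) (auto simp: nonzero_tuples_def)
  also have "?V \<union> ?N = ?I \<rightarrow>\<^sub>E carrier R"
    by (auto simp: nonzero_tuples_def)
  also have "card \<dots> = n ^ k"
    using n by (simp add: card_PiE)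
  finally have "real (card ?V + card ?N) = real (n ^ k)"
    by (rule arg_cong)
  then have "real (card ?V) + real (card ?N) = real n ^ k"
    unfolding of_nat_add of_nat_power .
  then have zp: "zp k R = (real n ^ k - real (card ?N)) / real n ^ k"
    using assms(4) by (simp add: zp_def field_simps)

  have finZ: "finite (zero_divisors R)"
    using assms(3) finite_subset[OF zero_divisors_subset] by auto
  have "card (zero_divisors R) \<ge> 1"
    using zero_mem_zero_divisors[OF assms(2)] finZ by (simp add: Suc_le_eq card_gt_0_iff) blast
  then have z1: "real (card (zero_divisors R) - 1) = z - 1"
    by (simp add: z_def of_nat_diff)
  have "card (zero_divisors R) \<le> n"
    using card_mono[OF assms(3) zero_divisors_subset] n by simp
  then have u: "real (card (regular_elements R)) = real n - z"
    using card_Diff_subset[OF finZ zero_divisors_subset] n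
    by (simp add: regular_elements_def z_def of_nat_diff)
  have "real (card ?S) = (real n - z) ^ k + real k * ((z - 1) * (real n - z) ^ (k - 1))"
    using card_sparse_tuples[OF assms(2) _ assms(3), of ?I]
    by (simp add: z1[simplified] u)
  also have "(real n - z) ^ k = (real n - z) * (real n - z) ^ (k - 1)"
    using assms(5) by (cases k) auto
  finally have "real (card ?S) = (real n + (real k - 1) * z - real k) * (real n - z) ^ (k - 1)"
    by (simp add: algebra_simps)
  then have bound: "bound = (real n ^ k - real (card ?S)) / real n ^ k"
    by (simp add: bound_def)

  have "zp k R \<le> bound"
    unfolding zp bound using card_mono[OF finN SN] npos by (simp add: divide_right_mono)
  moreover have "zp k R = bound \<longleftrightarrow> card ?S = card ?N"
    unfolding zp bound using npos by auto
  moreover have "card ?S = card ?N \<longleftrightarrow> ?N \<subseteq> ?S"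
    using card_subset_eq[OF finN SN] SN by auto
  moreover have "?N \<subseteq> ?S \<longleftrightarrow>
      (\<forall>x \<in> zero_divisors R. \<forall>y \<in> zero_divisors R. x \<otimes>\<^bsub>R\<^esub> y = \<zero>\<^bsub>R\<^esub>)"
    using assms(2,5) by (intro nonzero_tuples_sparse_iff[of _ 1 2]) auto
  ultimately show ?thesis by blast
qed

end
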